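(* Let $\mathcal{A}=(Q,\delta,I,Q_F\cup\delta_F)$ be a Büchi automaton with accepting states and accepting transitions, and let $\mathrm{Schewe}(\mathcal{A})$ be the state-based Büchi automaton constructed below. Then $\mathcal{L}(\mathrm{Schewe}(\mathcal{A}))=\Sigma^\omega\setminus\mathcal{L}(\mathcal{A})$.
   Context: $\Sigma$ is a finite nonempty alphabet, $\omega=\{0,1,2,\dots\}$. A Büchi automaton (BA) is $\mathcal{A}=(Q,\delta,I,Q_F\cup\delta_F)$ with finite state set $Q$, transition function $\delta\colon Q\times\Sigma\to 2^Q$ (also viewed as a set of transitions $p\xrightarrow{a}q$ with $q\in\delta(p,a)$), initial states $I\subseteq Q$, accepting states $Q_F\subseteq Q$ and accepting transitions $\delta_F\subseteq\delta$. For $P\subseteq Q$, $\delta(P,a)=\bigcup_{p\in P}\delta(p,a)$; $\delta_F(q,a)=\{q'\mid q\xrightarrow{a}q'\in\delta_F\}$. A run on $\alpha=\alpha_0\alpha_1\cdots\in\Sigma^\omega$ from $q$ is $\rho\colon\omega\to Q$ with $\rho_0=q$, $\rho_{i+1}\in\delta(\rho_i,\alpha_i)$; it is accepting iff a state of $Q_F$ occurs infinitely often or a transition of $\delta_F$ is taken infinitely often. $\mathcal{L}(\mathcal{A})$: words with an accepting run from some initial state. For a state-based BA (no accepting transitions) acceptance means visiting the accepting states infinitely often. Let $n=|Q|$, and let $\lfloor i\rfloor_{\mathrm{even}}$ denote the largest even number $\le i$. A (level) ranking is $f\colon Q\to\{0,1,\dots,2n\}$ with $f(q)$ even for all $q\in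 Q_F$; $\mathrm{rank}(f)=\max_{q}f(q)$. For $S\subseteq Q$, $f$ is $S$-tight if $r=\mathrm{rank}(f)$ is odd, $f(S)\supseteq\{1,3,\dots,r\}$ and $f(q)=0$ for all $q\in Q\setminus S$; $\mathcal{T}$ is the set of $Q$-tight rankings. For rankings $f,f'$, $a\in\Sigma$, $S\subseteq Q$, write $f\rhd^a_S f'$ iff for every $q\in S$ and $q'\in\delta(q,a)$ we have $f'(q')\le f(q)$, and for every $q''\in\delta_F(q,a)$ we have $f'(q'')\le\lfloor f(q)\rfloor_{\mathrm{even}}$. $\mathrm{Schewe}(\mathcal{A})=(Q',\delta',I',Q'_F)$ is the state-based BA with $Q'=Q_1\cup Q_2$, where $Q_1=2^Q$ and $Q_2=\{(S,O,f,i)\mid S,O\subseteq Q,\ f\in\mathcal{T},\ i\in\{0,2,\dots,2n-2\},\ f \text{ is } S\text{-tight},\ O\subseteq S\cap f^{-1}(i)\}$; $I'=\{I\}$; the transitions are: (1) $S\xrightarrow{a}\delta(S,a)$ for $S\in Q_1$; (2) $S\xrightarrow{a}(S',\emptyset,f,0)$ for $S\in Q_1$, $S'=\delta(S,a)$ and every $S'$-tight $f$ with $(S',\emptyset,f,0)\in Q_2$; (3) for $(S,O,f,i),(S',O',f',i')\in Q_2$, $(S,O,f,i)\xrightarrow{a}(S',O',f',i')$ iff $S'=\delta(S,a)$, $f\rhd^a_S f'$, $\mathrm{rank}(f)=\mathrm{rank}(f')$, and: if $O=\emptyset$ then $i'=(i+2)\bmod(\mathrm{rank}(f')+1)$ and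 $O'=f'^{-1}(i')$; if $O\neq\emptyset$ then $i'=i$ and $O'=\delta(O,a)\cap f'^{-1}(i)$. The accepting states are $Q'_F=\{\emptyset\}\cup\{(S,\emptyset,f,i)\in Q_2\}$.
   Formalization: In transition (3) with O=∅, O' is taken as S'∩f'^{-1}(i') instead of f'^{-1}(i'); since f' is 0 outside S', the literal formula for i'=0 and S'≠Q leaves Q_2 and makes the claim false (e.g. Q={p,q}, I={p}, δ(p,a)={p}, δ(q,a)=∅, no acceptance). *)

theory Defs
  imports Main "HOL-Library.Infinite_Set" "HOL-Library.FuncSet"
begin

text \<open>The alphabet is the type \<open>'a\<close>, of class \<open>finite\<close> in the main theorem; words are
  functions \<open>nat \<Rightarrow> 'a\<close>. State sets are explicit carriers, so the empty state set is allowed.\<close>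

record ('q, 'a) ba =
  states :: "'q set"
  delta :: "'q \<Rightarrow> 'a \<Rightarrow> 'q set"
  initial :: "'q set"
  acc_states :: "'q set"
  acc_trans :: "('q \<times> 'a \<times> 'q) set"

definition buchi_automaton :: "('q, 'a) ba \<Rightarrow> bool" where
  "buchi_automaton A \<longleftrightarrow>
     finite (states A) \<and>
     (\<forall>q\<in>states A. \<forall>a. delta A q a \<subseteq> states A) \<and>
     initial A \<subseteq> states A \<and>
     acc_states A \<subseteq> states A \<and>
     acc_trans A \<subseteq> {(p, a, q). p \<in> states A \<and> q \<in> delta A p a}"

definition delta_set :: "('q, 'a) ba \<Rightarrow> 'q set \<Rightarrow> 'a \<Rightarrow> 'q set" where
  "delta_set A P a = (\<Union>p\<in>P. delta A p a)"

definition delta_acc :: "('q, 'a) ba \<Rightarrow> 'q \<Rightarrow> 'a \<Rightarrow> 'q set" where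
  "delta_acc A q a = {q'. (q, a, q') \<in> acc_trans A}"

definition is_run :: "('q, 'a) ba \<Rightarrow> (nat \<Rightarrow> 'a) \<Rightarrow> 'q \<Rightarrow> (nat \<Rightarrow> 'q) \<Rightarrow> bool" where
  "is_run A \<alpha> q \<rho> \<longleftrightarrow>
     (\<forall>i. \<rho> i \<in> states A) \<and> \<rho> 0 = q \<and> (\<forall>i. \<rho> (Suc i) \<in> delta A (\<rho> i) (\<alpha> i))"

definition accepting_run :: "('q, 'a) ba \<Rightarrow> (nat \<Rightarrow> 'a) \<Rightarrow> (nat \<Rightarrow> 'q) \<Rightarrow> bool" where
  "accepting_run A \<alpha> \<rho> \<longleftrightarrow>
     (\<exists>q\<in>acc_states A. \<exists>\<^sub>\<infinity>i. \<rho> i = q) \<or>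
     (\<exists>t\<in>acc_trans A. \<exists>\<^sub>\<infinity>i. (\<rho> i, \<alpha> i, \<rho> (Suc i)) = t)"

definition language :: "('q, 'a) ba \<Rightarrow> (nat \<Rightarrow> 'a) set" where
  "language A = {\<alpha>. \<exists>q\<in>initial A. \<exists>\<rho>. is_run A \<alpha> q \<rho> \<and> accepting_run A \<alpha> \<rho>}"

definition even_floor :: "nat \<Rightarrow> nat" where
  "even_floor i = Max {j. j \<le> i \<and> even j}"

text \<open>Rankings are extensional functions on the carrier, so that there are only finitely
  many of them.\<close>

definition rankings :: "('q, 'a) ba \<Rightarrow> ('q \<Rightarrow> nat) set" where
  "rankings A =
     {f \<in> states A \<rightarrow>\<^sub>E {0..2 * card (states A)}. \<forall>q\<in>acc_states A. even (f q)}"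

definition rank :: "('q, 'a) ba \<Rightarrow> ('q \<Rightarrow> nat) \<Rightarrow> nat" where
  "rank A f = Max (f ` states A)"

definition tight :: "('q, 'a) ba \<Rightarrow> 'q set \<Rightarrow> ('q \<Rightarrow> nat) \<Rightarrow> bool" where
  "tight A S f \<longleftrightarrow>
     f \<in> rankings A \<and>
     odd (rank A f) \<and>
     {k. odd k \<and> k \<le> rank A f} \<subseteq> f ` S \<and>
     (\<forall>q\<in>states A - S. f q = 0)"

definition tight_rankings :: "('q, 'a) ba \<Rightarrow> ('q \<Rightarrow> nat) set" where
  "tight_rankings A = {f. tight A (states A) f}"

definition rank_step ::
  "('q, 'a) ba \<Rightarrow> 'a \<Rightarrow> 'q set \<Rightarrow> ('q \<Rightarrow> nat) \<Rightarrow> ('q \<Rightarrow> nat) \<Rightarrow> bool" where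
  "rank_step A a S f f' \<longleftrightarrow>
     (\<forall>q\<in>S. (\<forall>q'\<in>delta A q a. f' q' \<le> f q) \<and>
            (\<forall>q''\<in>delta_acc A q a. f' q'' \<le> even_floor (f q)))"

datatype 'q schewe_state =
    Waiting "'q set"
  | Tight "'q set" "'q set" "'q \<Rightarrow> nat" nat

definition schewe_Q1 :: "('q, 'a) ba \<Rightarrow> 'q schewe_state set" where
  "schewe_Q1 A = {Waiting S | S. S \<subseteq> states A}"

text \<open>The condition \<open>i < 2 * n\<close> for even \<open>i\<close> expresses \<open>i \<in> {0, 2, \<dots>, 2n - 2}\<close> without
  truncated subtraction.\<close>

definition schewe_Q2 :: "('q, 'a) ba \<Rightarrow> 'q schewe_state set" where
  "schewe_Q2 A =
     {Tight S Ob f i | S Ob f i.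
        S \<subseteq> states A \<and> Ob \<subseteq> states A \<and> f \<in> tight_rankings A \<and>
        even i \<and> i < 2 * card (states A) \<and>
        tight A S f \<and> Ob \<subseteq> S \<inter> f -` {i}}"

text \<open>In the case \<open>Ob = {}\<close> the preimage of \<open>i'\<close> under \<open>f'\<close> is taken within \<open>S'\<close>. As \<open>f'\<close>
  is set to 0 outside \<open>S'\<close>, the preimage of 0 in the whole state set need not be contained
  in \<open>S'\<close>, as membership in \<^const>\<open>schewe_Q2\<close> requires.\<close>

fun schewe_step ::
  "('q, 'a) ba \<Rightarrow> 'q schewe_state \<Rightarrow> 'a \<Rightarrow> 'q schewe_state \<Rightarrow> bool" where
  "schewe_step A (Waiting S) a (Waiting S') \<longleftrightarrow> S' = delta_set A S a"
| "schewe_step A (Waiting S) a (Tight S' Ob' f' i') \<longleftrightarrow>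
     S' = delta_set A S a \<and> Ob' = {} \<and> i' = 0"
| "schewe_step A (Tight S Ob f i) a (Waiting S') \<longleftrightarrow> False"
| "schewe_step A (Tight S Ob f i) a (Tight S' Ob' f' i') \<longleftrightarrow>
     S' = delta_set A S a \<and> rank_step A a S f f' \<and> rank A f = rank A f' \<and>
     (if Ob = {}
      then i' = (i + 2) mod (rank A f' + 1) \<and> Ob' = S' \<inter> f' -` {i'}
      else i' = i \<and> Ob' = delta_set A Ob a \<inter> f' -` {i})"

definition schewe :: "('q, 'a) ba \<Rightarrow> ('q schewe_state, 'a) ba" where
  "schewe A =
     \<lparr>states = schewe_Q1 A \<union> schewe_Q2 A,
      delta = (\<lambda>s a. {s'. s \<in> schewe_Q1 A \<union> schewe_Q2 A \<and>
                          s' \<in> schewe_Q1 A \<union> schewe_Q2 A \<and> schewe_step A s a s'}),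
      initial = {Waiting (initial A)},
      acc_states = {Waiting {}} \<union> {Tight S {} f i | S f i. Tight S {} f i \<in> schewe_Q2 A},
      acc_trans = {}\<rparr>"

lemma finite_schewe_states:
  assumes "finite (states A)"
  shows "finite (schewe_Q1 A \<union> schewe_Q2 A)"
proof -
  have "schewe_Q1 A = Waiting ` Pow (states A)"
    by (auto simp: schewe_Q1_def)
  moreover have "schewe_Q2 A \<subseteq> (\<lambda>(S, Ob, f, i). Tight S Ob f i) `
      (Pow (states A) \<times> Pow (states A) \<times>
       (states A \<rightarrow>\<^sub>E {0..2 * card (states A)}) \<times> {..<2 * card (states A)})"
    by (force simp: schewe_Q2_def tight_def rankings_def image_iff)
  moreover have "finite (states A \<rightarrow>\<^sub>E {0..2 * card (states A)})"
    using assms by (intro finite_PiE) auto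
  ultimately show ?thesis
    using assms by (auto intro: finite_subset)
qed

lemma buchi_automaton_schewe:
  assumes "buchi_automaton A"
  shows "buchi_automaton (schewe A)"
  using assms finite_schewe_states[of A]
  by (auto simp: buchi_automaton_def schewe_def schewe_Q1_def)

end

theory Submission
  imports Defs
begin

text \<open>A rejected word with nonempty levels induces the Kupferman-Vardi ranking of the run graph:
  alternately remove the vertices without an infinite path and those that cannot reach an accepting
  state or transition. Since the word is rejected, every nonempty odd stage loses a vertex, and
  then a vertex on every later level, so there are at most \<open>n\<close> odd stages and the ranking is
  eventually tight. By Koenig's lemma no obligation set can stay nonempty, since it would contain
  an infinite path of constant even rank. Conversely, along a tight run of the complement
  the rank of an accepting path settles on an even value, and the path is caught in an obligation set.\<close>

section \<open>Koenig's lemma and two facts on natural numbers\<close>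

text \<open>Going back through predecessors yields paths of every length from every level. By
  finiteness some vertex starts paths of all lengths, and this property passes on to one of its
  successors.\<close>

lemma koenig:
  fixes E :: "nat \<Rightarrow> 'b \<Rightarrow> 'b \<Rightarrow> bool"
  assumes fin: "\<And>l. finite (L l)"
    and ne: "\<And>l. L l \<noteq> {}"
    and pred: "\<And>l w. w \<in> L (Suc l) \<Longrightarrow> \<exists>v\<in>L l. E l v w"
  shows "\<exists>\<rho>. \<forall>l. \<rho> l \<in> L l \<and> E l (\<rho> l) (\<rho> (Suc l))"
proof -
  \<comment> \<open>\<open>H k l v\<close> says that \<open>v\<close> starts a path of
    \<open>k\<close> edges through the levels \<open>l\<close> to \<open>l + k\<close>.\<close>
  define H where "H = rec_nat (\<lambda>l v. v \<in> L l)
    (\<lambda>k h l v. v \<in> L l \<and> (\<exists>w\<in>L (Suc l). E l v w \<and> h (Suc l) w))"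
  have H0: "H 0 l v \<longleftrightarrow> v \<in> L l" for l v
    by (simp add: H_def)
  have HS: "H (Suc k) l v \<longleftrightarrow> v \<in> L l \<and> (\<exists>w\<in>L (Suc l). E l v w \<and> H k (Suc l) w)" for k l v
    by (simp add: H_def)
  have HL: "H k l v \<Longrightarrow> v \<in> L l" for k l v
    by (cases k) (auto simp: H0 HS)
  have H_Suc: "H (Suc k) l v \<Longrightarrow> H k l v" for k l v
  proof (induction k arbitrary: l v)
    case 0
    then show ?case by (simp add: H0 HS)
  next
    case (Suc k)
    then show ?case by (metis HS)
  qed
  have H_anti: "H k' l v" if "k' \<le> k" "H k l v" for k k' l v
    using that by (induction k rule: dec_induct) (auto intro: H_Suc)
  have H_ex: "\<exists>v. H k l v" for k l
  proof (induction k arbitrary: l)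
    case 0
    then show ?case using ne[of l] by (auto simp: H0)
  next
    case (Suc k)
    then obtain w where "H k (Suc l) w" by blast
    then show ?case using pred HL by (metis HS)
  qed
  \<comment> \<open>If every vertex with \<open>P\<close> failed at some length, the maximum of
    these lengths over the finite level would defeat all of them. Taking \<open>P\<close> to be
    \<open>E l v\<close> keeps the choice among the successors of \<open>v\<close>.\<close>
  have pigeon: "\<exists>v. P v \<and> (\<forall>k. H k l v)" if ex: "\<And>k. \<exists>v. P v \<and> H k l v" for P l
  proof (rule ccontr)
    assume "\<not> ?thesis"
    then have "\<forall>v. \<exists>k. P v \<longrightarrow> \<not> H k l v" by blast
    then obtain b where b: "\<And>v. P v \<Longrightarrow> \<not> H (b v) l v" by metis
    obtain v where v: "P v" "H (Max (insert 0 (b ` L l))) l v" using ex by blast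
    have "b v \<le> Max (insert 0 (b ` L l))"
      using HL[OF v(2)] fin by (intro Max_ge) auto
    then show False using b v H_anti by blast
  qed
  have "\<exists>\<rho>. \<forall>l. (\<forall>k. H k l (\<rho> l)) \<and> E l (\<rho> l) (\<rho> (Suc l))"
  proof (rule dependent_nat_choice)
    show "\<exists>v. \<forall>k. H k 0 v"
      using pigeon[of "\<lambda>_. True" 0] H_ex by blast
    show "\<exists>w. (\<forall>k. H k (Suc l) w) \<and> E l v w" if "\<forall>k. H k l v" for v l
    proof -
      have "\<exists>w. E l v w \<and> H k (Suc l) w" for k
        using that HS by blast
      then show ?thesis using pigeon[of "E l v" "Suc l"] by blast
    qed
  qed
  then show ?thesis using HL by blast
qed

lemma even_floor_eq: "even_floor i = (if even i then i else i - 1)"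
  unfolding even_floor_def
proof (rule Max_eqI)
  show "y \<le> (if even i then i else i - 1)" if "y \<in> {j. j \<le> i \<and> even j}" for y
    using that by (cases "y = i") auto
qed (auto intro: finite_subset[of _ "{..i}"])

lemma antimono_nat_eventually_const:
  fixes g :: "nat \<Rightarrow> nat"
  assumes "\<And>j. j \<ge> k \<Longrightarrow> g (Suc j) \<le> g j"
  shows "\<exists>l\<ge>k. \<forall>j\<ge>l. g j = g l"
proof -
  obtain l where l: "l \<ge> k" "\<And>j. j \<ge> k \<Longrightarrow> g l \<le> g j"
    using arg_min_nat_lemma[of "\<lambda>j. j \<ge> k" k g] by blast
  have "g j \<le> g l" if "j \<ge> l" for j
    using that
  proof (induction j rule: dec_induct)
    case (step j)
    then show ?case using assms[of j] l(1) by simp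
  qed simp
  then show ?thesis using l by (meson le_antisym order_trans)
qed

section \<open>Levels and runs on a fixed word\<close>

locale ba_word =
  fixes A :: "('q, 'a :: finite) ba" and \<alpha> :: "nat \<Rightarrow> 'a"
  assumes ba: "buchi_automaton A"
begin

primrec level :: "nat \<Rightarrow> 'q set" where
  "level 0 = initial A"
| "level (Suc l) = delta_set A (level l) (\<alpha> l)"

text \<open>An accepting state is charged to the transition leaving it, so that both kinds of
  acceptance become one condition on edges.\<close>

definition good :: "nat \<Rightarrow> 'q \<Rightarrow> 'q \<Rightarrow> bool" where
  "good l p q \<longleftrightarrow> p \<in> acc_states A \<or> (p, \<alpha> l, q) \<in> acc_trans A"

lemma finite_states: "finite (states A)"
  using ba by (simp add: buchi_automaton_def)

lemma level_subset: "level l \<subseteq> states A"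
proof (induction l)
  case 0
  then show ?case using ba by (simp add: buchi_automaton_def)
next
  case (Suc l)
  then show ?case using ba by (auto simp: buchi_automaton_def delta_set_def)
qed

lemma finite_level: "finite (level l)"
  using level_subset finite_states finite_subset by blast

lemma level_step: "p \<in> level l \<Longrightarrow> q \<in> delta A p (\<alpha> l) \<Longrightarrow> q \<in> level (Suc l)"
  by (auto simp: delta_set_def)

lemma run_in_level:
  assumes "is_run A \<alpha> q \<rho>" "q \<in> initial A"
  shows "\<rho> l \<in> level l"
  using assms by (induction l) (auto simp: is_run_def delta_set_def)

text \<open>Supplies the finite prefix that turns an infinite path from a later level into a run
  from an initial state.\<close>

lemma level_run:
  assumes "p \<in> level l"
  shows "\<exists>\<rho>. \<rho> 0 \<in> initial A \<and> \<rho> l = p \<and> (\<forall>j<l. \<rho> j \<in> states A \<and> \<rho> (Suc j) \<in> delta A (\<rho> j) (\<alpha> j))"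
  using assms
proof (induction l arbitrary: p)
  case 0
  then show ?case by (auto intro!: exI[of _ "\<lambda>_. p"])
next
  case (Suc l)
  then obtain q where q: "q \<in> level l" "p \<in> delta A q (\<alpha> l)"
    by (auto simp: delta_set_def)
  with Suc.IH obtain \<rho> where "\<rho> 0 \<in> initial A" "\<rho> l = q"
    "\<forall>j<l. \<rho> j \<in> states A \<and> \<rho> (Suc j) \<in> delta A (\<rho> j) (\<alpha> j)" by blast
  then show ?case using q level_subset
    by (intro exI[of _ "\<rho>(Suc l := p)"]) (auto simp: less_Suc_eq)
qed

text \<open>Acceptance fixes one state or transition that recurs. Both accepting sets are finite,
  the second because the alphabet is, so the witness may vary with the position.\<close>

lemma accepting_run_iff_good:
  assumes "is_run A \<alpha> q \<rho>"
  shows "accepting_run A \<alpha> \<rho> \<longleftrightarrow> (\<exists>\<^sub>\<infinity>j. good j (\<rho> j) (\<rho> (Suc j)))"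
proof -
  have "acc_trans A \<subseteq> states A \<times> UNIV \<times> states A"
    using ba by (fastforce simp: buchi_automaton_def)
  then have "finite (acc_trans A)"
    using finite_states by (meson finite_SigmaI finite_UNIV finite_subset)
  moreover have "finite (acc_states A)"
    using ba by (auto simp: buchi_automaton_def intro: finite_subset)
  ultimately have "accepting_run A \<alpha> \<rho> \<longleftrightarrow> (\<exists>\<^sub>\<infinity>j. \<exists>q\<in>acc_states A. \<rho> j = q) \<or>
    (\<exists>\<^sub>\<infinity>j. \<exists>t\<in>acc_trans A. (\<rho> j, \<alpha> j, \<rho> (Suc j)) = t)"
    unfolding accepting_run_def by (simp only: frequently_bex_finite_distrib)
  also have "\<dots> \<longleftrightarrow> (\<exists>\<^sub>\<infinity>j. good j (\<rho> j) (\<rho> (Suc j)))"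
    by (simp add: good_def flip: frequently_disj_iff)
  finally show ?thesis .
qed

section \<open>Infinite paths and the stages of the run graph\<close>

text \<open>Paths are indexed by absolute levels and unconstrained below \<open>l\<close>, so a tail
  of a path is the same function.\<close>

definition ipath :: "(nat \<Rightarrow> 'q set) \<Rightarrow> nat \<Rightarrow> (nat \<Rightarrow> 'q) \<Rightarrow> bool" where
  "ipath V l \<rho> \<longleftrightarrow> (\<forall>j\<ge>l. \<rho> j \<in> V j \<and> \<rho> (Suc j) \<in> delta A (\<rho> j) (\<alpha> j))"

lemma ipath_later: "ipath V l \<rho> \<Longrightarrow> l \<le> l' \<Longrightarrow> ipath V l' \<rho>"
  by (simp add: ipath_def)

lemma ipath_append:
  assumes "\<And>j. l \<le> j \<Longrightarrow> j < l' \<Longrightarrow> \<rho> j \<in> V j \<and> \<rho> (Suc j) \<in> delta A (\<rho> j) (\<alpha> j)"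
    and "ipath V l' \<sigma>" "\<sigma> l' = \<rho> l'"
  shows "ipath V l (\<lambda>j. if j < l' then \<rho> j else \<sigma> j)"
  unfolding ipath_def
proof (intro allI impI conjI)
  fix j assume "l \<le> j"
  then show "(if j < l' then \<rho> j else \<sigma> j) \<in> V j"
    using assms by (auto simp: ipath_def)
  show "(if Suc j < l' then \<rho> (Suc j) else \<sigma> (Suc j)) \<in> delta A (if j < l' then \<rho> j else \<sigma> j) (\<alpha> j)"
    using assms \<open>l \<le> j\<close> by (cases "Suc j = l'") (auto simp: ipath_def)
qed

lemma ipath_Cons:
  assumes "p \<in> V l" "q \<in> delta A p (\<alpha> l)" "ipath V (Suc l) \<sigma>" "\<sigma> (Suc l) = q"
  shows "ipath V l (\<sigma>(l := p))"
proof -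
  have "ipath V l (\<lambda>j. if j < Suc l then (\<sigma>(l := p)) j else \<sigma> j)"
    using assms by (intro ipath_append) (auto simp: less_Suc_eq)
  then show ?thesis by (auto simp: ipath_def)
qed

text \<open>\<open>stage k\<close> will be the set of vertices of rank at least \<open>k\<close>.
  For odd \<open>k\<close> the good edge may be demanded on an infinite path, since every vertex of
  an odd stage starts one inside that stage.\<close>

primrec stage :: "nat \<Rightarrow> nat \<Rightarrow> 'q set" where
  "stage 0 = level"
| "stage (Suc k) = (\<lambda>l. {\<rho> l | \<rho>. ipath (stage k) l \<rho> \<and>
     (odd k \<longrightarrow> (\<exists>j\<ge>l. good j (\<rho> j) (\<rho> (Suc j))))})"

lemma stage_Suc_iff: "q \<in> stage (Suc k) l \<longleftrightarrow>
    (\<exists>\<rho>. ipath (stage k) l \<rho> \<and> \<rho> l = q \<and> (odd k \<longrightarrow> (\<exists>j\<ge>l. good j (\<rho> j) (\<rho> (Suc j)))))"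
  by auto

declare stage.simps(2) [simp del]

lemma stage_antimono: "k \<le> k' \<Longrightarrow> stage k' l \<subseteq> stage k l"
proof (induction k' rule: dec_induct)
  case (step k')
  have "stage (Suc k') l \<subseteq> stage k' l"
    by (auto simp: stage_Suc_iff ipath_def)
  then show ?case using step by blast
qed simp

lemma stage_subset_level: "stage k l \<subseteq> level l"
  using stage_antimono[of 0 k] by simp

lemma stage_subset_states: "stage k l \<subseteq> states A"
  using stage_subset_level level_subset by blast

text \<open>Prepending \<open>p\<close> to a witness for \<open>q\<close> gives a witness for
  \<open>p\<close>. Hence ranks do not increase along edges, and descendants of removed vertices are
  removed.\<close>

lemma stage_pred_closed:
  assumes "q \<in> stage k (Suc l)" "p \<in> level l" "q \<in> delta A p (\<alpha> l)"
  shows "p \<in> stage k l"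
  using assms(1)
proof (induction k)
  case 0
  then show ?case using assms by simp
next
  case (Suc k)
  then obtain \<sigma> where \<sigma>: "ipath (stage k) (Suc l) \<sigma>" "\<sigma> (Suc l) = q"
    "odd k \<longrightarrow> (\<exists>j\<ge>Suc l. good j (\<sigma> j) (\<sigma> (Suc j)))"
    by (auto simp: stage_Suc_iff)
  have "p \<in> stage k l"
    using Suc stage_antimono[of k "Suc k"] by auto
  then have "ipath (stage k) l (\<sigma>(l := p))"
    using ipath_Cons assms \<sigma> by blast
  moreover have "odd k \<longrightarrow> (\<exists>j\<ge>l. good j ((\<sigma>(l := p)) j) ((\<sigma>(l := p)) (Suc j)))"
  proof
    assume "odd k"
    then obtain j where "j \<ge> Suc l" "good j (\<sigma> j) (\<sigma> (Suc j))" using \<sigma> by blast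
    then show "\<exists>j\<ge>l. good j ((\<sigma>(l := p)) j) ((\<sigma>(l := p)) (Suc j))"
      by (intro exI[of _ j]) auto
  qed
  ultimately show ?case
    by (auto simp: stage_Suc_iff intro!: exI[of _ "\<sigma>(l := p)"])
qed

text \<open>The tails of a path in the even stage below witness that all its later vertices survive
  too, so the path itself lies in the odd stage.\<close>

lemma stage_odd_ipath:
  assumes "odd k" "q \<in> stage k l"
  shows "\<exists>\<rho>. ipath (stage k) l \<rho> \<and> \<rho> l = q"
proof -
  obtain k' where k: "k = Suc k'" "even k'" using assms(1) by (cases k) auto
  then obtain \<rho> where \<rho>: "ipath (stage k') l \<rho>" "\<rho> l = q"
    using assms by (auto simp: stage_Suc_iff)
  have "\<rho> j \<in> stage k j" if "j \<ge> l" for j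
    using ipath_later[OF \<rho>(1) that] k by (auto simp: stage_Suc_iff)
  then show ?thesis using \<rho> by (auto simp: ipath_def)
qed

text \<open>The good edge extends to an infinite path inside the odd stage. This is the source of
  the \<open>even_floor\<close> condition in \<open>rank_step\<close>.\<close>

lemma stage_odd_good:
  assumes "odd k" "p \<in> stage k l" "q \<in> stage k (Suc l)" "q \<in> delta A p (\<alpha> l)" "good l p q"
  shows "p \<in> stage (Suc k) l"
proof -
  obtain \<rho> where \<rho>: "ipath (stage k) (Suc l) \<rho>" "\<rho> (Suc l) = q"
    using stage_odd_ipath assms by blast
  then have "ipath (stage k) l (\<rho>(l := p))"
    using ipath_Cons assms by blast
  then show ?thesis using assms \<rho>
    by (auto simp: stage_Suc_iff intro!: exI[of _ "\<rho>(l := p)"] exI[of _ l])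
qed

text \<open>The first edge of an infinite path from \<open>p\<close> is already good. Consequently
  accepting states never receive an odd rank.\<close>

lemma stage_acc_state:
  assumes "odd k" "p \<in> stage k l" "p \<in> acc_states A"
  shows "p \<in> stage (Suc k) l"
proof -
  obtain \<rho> where "ipath (stage k) l \<rho>" "\<rho> l = p"
    using stage_odd_ipath assms by blast
  then show ?thesis using assms stage_odd_good[of k p l "\<rho> (Suc l)"]
    by (auto simp: ipath_def good_def)
qed

text \<open>If no vertex is removed, following at each vertex a path with the least delay to a good
  transition produces an accepting run.\<close>

lemma stage_odd_removes:
  assumes rej: "\<alpha> \<notin> language A" and k: "odd k" and q0: "q0 \<in> stage k l0"
  shows "\<exists>l q. q \<in> stage k l - stage (Suc k) l"
proof (rule ccontr)
  assume "\<not> ?thesis"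
  then have all: "q \<in> stage k l \<Longrightarrow> q \<in> stage (Suc k) l" for q l by blast
  define W where "W l q d \<longleftrightarrow> (\<exists>\<rho>. ipath (stage k) l \<rho> \<and> \<rho> l = q \<and>
    good (l + d) (\<rho> (l + d)) (\<rho> (Suc (l + d))))" for l q d
  define D where "D l q = (LEAST d. W l q d)" for l q
  have W_ex: "\<exists>d. W l q d" if q: "q \<in> stage k l" for l q
  proof -
    obtain \<rho> j where "ipath (stage k) l \<rho>" "\<rho> l = q" "j \<ge> l" "good j (\<rho> j) (\<rho> (Suc j))"
      using all[OF q] k by (auto simp: stage_Suc_iff)
    then show ?thesis unfolding W_def by (intro exI[of _ "j - l"] exI[of _ \<rho>]) simp
  qed
  \<comment> \<open>On a path realizing the least delay \<open>D l q\<close>, either the first edge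
    is good or the tail shows that the delay has dropped.\<close>
  have next_ex: "\<exists>q'. q' \<in> stage k (Suc l) \<and> q' \<in> delta A q (\<alpha> l) \<and>
      (good l q q' \<or> D (Suc l) q' < D l q)" if q: "q \<in> stage k l" for l q
  proof -
    have "W l q (D l q)"
      unfolding D_def using W_ex[OF q] by (rule LeastI_ex)
    then obtain \<rho> where \<rho>: "ipath (stage k) l \<rho>" "\<rho> l = q"
      "good (l + D l q) (\<rho> (l + D l q)) (\<rho> (Suc (l + D l q)))"
      by (auto simp: W_def)
    have "good l q (\<rho> (Suc l)) \<or> D (Suc l) (\<rho> (Suc l)) < D l q"
    proof (cases "D l q")
      case 0
      then show ?thesis using \<rho> by simp
    next
      case (Suc d)
      then have "W (Suc l) (\<rho> (Suc l)) d"
        using \<rho> ipath_later[OF \<rho>(1), of "Suc l"] by (auto simp: W_def)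
      then have "D (Suc l) (\<rho> (Suc l)) \<le> d"
        unfolding D_def by (rule Least_le)
      then show ?thesis using Suc by simp
    qed
    then show ?thesis using \<rho> by (intro exI[of _ "\<rho> (Suc l)"]) (auto simp: ipath_def)
  qed
  have "\<exists>\<sigma>. \<forall>n. (\<sigma> n \<in> stage k (l0 + n) \<and> (n = 0 \<longrightarrow> \<sigma> n = q0)) \<and>
      (\<sigma> (Suc n) \<in> delta A (\<sigma> n) (\<alpha> (l0 + n)) \<and>
        (good (l0 + n) (\<sigma> n) (\<sigma> (Suc n)) \<or> D (Suc (l0 + n)) (\<sigma> (Suc n)) < D (l0 + n) (\<sigma> n)))"
    by (rule dependent_nat_choice) (use q0 next_ex in auto)
  then obtain \<sigma> where \<sigma>: "\<And>n. \<sigma> n \<in> stage k (l0 + n)" "\<sigma> 0 = q0"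
    "\<And>n. \<sigma> (Suc n) \<in> delta A (\<sigma> n) (\<alpha> (l0 + n))"
    "\<And>n. good (l0 + n) (\<sigma> n) (\<sigma> (Suc n)) \<or> D (Suc (l0 + n)) (\<sigma> (Suc n)) < D (l0 + n) (\<sigma> n)"
    by blast
  \<comment> \<open>The delay cannot decrease forever, so a good edge comes after every
    position.\<close>
  have often: "\<exists>n'\<ge>n. good (l0 + n') (\<sigma> n') (\<sigma> (Suc n'))" for n
  proof (induction "D (l0 + n) (\<sigma> n)" arbitrary: n rule: less_induct)
    case less
    then show ?case using \<sigma>(4)[of n] by (metis Suc_leD add_Suc_right order_refl)
  qed
  obtain \<pi> where \<pi>: "\<pi> 0 \<in> initial A" "\<pi> l0 = q0"
    "\<And>j. j < l0 \<Longrightarrow> \<pi> j \<in> states A \<and> \<pi> (Suc j) \<in> delta A (\<pi> j) (\<alpha> j)"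
    using level_run[of q0 l0] q0 stage_subset_level by blast
  \<comment> \<open>\<open>\<sigma>\<close> counts from level \<open>l0\<close>, hence the shift;
    \<open>\<pi>\<close> leads from an initial state to \<open>q0\<close>.\<close>
  define \<rho> where "\<rho> j = (if j < l0 then \<pi> j else \<sigma> (j - l0))" for j
  have "ipath (\<lambda>_. states A) 0 \<rho>"
    unfolding \<rho>_def
  proof (rule ipath_append)
    show "ipath (\<lambda>_. states A) l0 (\<lambda>j. \<sigma> (j - l0))"
      unfolding ipath_def
    proof (intro allI impI)
      fix j assume "j \<ge> l0"
      then obtain n where "j = l0 + n" using le_Suc_ex by blast
      then show "\<sigma> (j - l0) \<in> states A \<and> \<sigma> (Suc j - l0) \<in> delta A (\<sigma> (j - l0)) (\<alpha> j)"
        using \<sigma>(1)[of n] \<sigma>(3)[of n] stage_subset_states by auto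
    qed
  qed (use \<pi> \<sigma>(2) in auto)
  moreover have "\<rho> 0 \<in> initial A"
    using \<pi> \<sigma>(2) by (cases "l0 = 0") (auto simp: \<rho>_def)
  ultimately have run: "is_run A \<alpha> (\<rho> 0) \<rho>"
    by (auto simp: is_run_def ipath_def)
  have "\<exists>\<^sub>\<infinity>j. good j (\<rho> j) (\<rho> (Suc j))"
    unfolding INFM_nat_le
  proof
    fix m
    obtain n where "n \<ge> m" "good (l0 + n) (\<sigma> n) (\<sigma> (Suc n))" using often by blast
    then show "\<exists>j\<ge>m. good j (\<rho> j) (\<rho> (Suc j))"
      by (intro exI[of _ "l0 + n"]) (auto simp: \<rho>_def)
  qed
  then have "accepting_run A \<alpha> \<rho>"
    using accepting_run_iff_good[OF run] by blast
  then show False using rej run \<open>\<rho> 0 \<in> initial A\<close> by (auto simp: language_def)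
qed

text \<open>A removed vertex of an odd stage has an infinite path inside that stage, and by
  predecessor closure every vertex on this path is removed as well.\<close>

lemma stage_odd_persists:
  assumes k: "odd k" and q: "q \<in> stage k l - stage (Suc k) l" and "l \<le> l'"
  shows "stage k l' - stage (Suc k) l' \<noteq> {}"
proof -
  obtain \<rho> where \<rho>: "ipath (stage k) l \<rho>" "\<rho> l = q"
    using stage_odd_ipath k q by blast
  have "\<rho> l' \<notin> stage (Suc k) l'"
    using \<open>l \<le> l'\<close>
  proof (induction l' rule: dec_induct)
    case base
    then show ?case using \<rho> q by simp
  next
    case (step j)
    have "\<rho> j \<in> level j" "\<rho> (Suc j) \<in> delta A (\<rho> j) (\<alpha> j)"
      using \<rho> step stage_subset_level by (auto simp: ipath_def)
    then show ?case using stage_pred_closed step by blast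
  qed
  then show ?thesis using \<rho> \<open>l \<le> l'\<close> by (auto simp: ipath_def)
qed

section \<open>Bounding the number of nonempty odd stages\<close>

text \<open>Each of the finitely many odd stages loses vertices from some level on; the maximum of
  these levels serves them all.\<close>

lemma stage_odd_eventually:
  assumes "\<alpha> \<notin> language A" "\<And>k. odd k \<Longrightarrow> k \<le> K \<Longrightarrow> \<exists>l. stage k l \<noteq> {}"
  shows "\<exists>L. \<forall>l\<ge>L. \<forall>k\<le>K. odd k \<longrightarrow> stage k l - stage (Suc k) l \<noteq> {}"
proof -
  have "\<exists>L. \<forall>l\<ge>L. stage k l - stage (Suc k) l \<noteq> {}" if "odd k" "k \<le> K" for k
    using assms(2)[OF that] stage_odd_removes[OF assms(1) that(1)] stage_odd_persists[OF that(1)]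
    by (meson ex_in_conv)
  then obtain g where g: "\<And>k l. odd k \<Longrightarrow> k \<le> K \<Longrightarrow> l \<ge> g k \<Longrightarrow> stage k l - stage (Suc k) l \<noteq> {}"
    by metis
  have "g k \<le> Max (g ` {..K})" if "k \<le> K" for k
    using that by (intro Max_ge) auto
  then show ?thesis using g by (meson order_trans)
qed

text \<open>Stages decrease, so vertices of one level lost at different odd stages are
  distinct.\<close>

lemma card_odd_stages:
  assumes "\<And>k. odd k \<Longrightarrow> k < 2 * m \<Longrightarrow> stage k l - stage (Suc k) l \<noteq> {}"
  shows "m \<le> card (states A)"
proof -
  have "\<forall>k. \<exists>q. odd k \<longrightarrow> k < 2 * m \<longrightarrow> q \<in> stage k l - stage (Suc k) l"
    using assms by blast
  then obtain g where g: "\<And>k. odd k \<Longrightarrow> k < 2 * m \<Longrightarrow> g k \<in> stage k l - stage (Suc k) l"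
    by metis
  have inj: "inj_on (\<lambda>i. g (2 * i + 1)) {..<m}"
  proof (rule linorder_inj_onI')
    fix i j assume "i \<in> {..<m}" "j \<in> {..<m}" "i < j"
    then show "g (2 * i + 1) \<noteq> g (2 * j + 1)"
      using g[of "2 * i + 1"] g[of "2 * j + 1"] stage_antimono[of "Suc (2 * i + 1)" "2 * j + 1" l]
      by auto
  qed
  have "(\<lambda>i. g (2 * i + 1)) ` {..<m} \<subseteq> states A"
  proof safe
    fix i assume "i < m"
    then show "g (2 * i + 1) \<in> states A"
      using g[of "2 * i + 1"] stage_subset_states by auto
  qed
  from card_inj_on_le[OF inj this finite_states] show ?thesis by simp
qed

text \<open>If all levels of the stage were nonempty, Koenig's lemma would give an infinite path,
  which survives into the next stage as \<open>k\<close> is even. One empty level empties all later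
  ones, because every vertex of the stage has a predecessor in it.\<close>

lemma stage_dies_out:
  assumes "even k" "\<And>l. stage (Suc k) l = {}"
  shows "\<exists>L. \<forall>l\<ge>L. stage k l = {}"
proof -
  have pred: "\<exists>p\<in>stage k l. q \<in> delta A p (\<alpha> l)" if q: "q \<in> stage k (Suc l)" for q l
  proof -
    have "q \<in> level (Suc l)" using q stage_subset_level by blast
    then obtain p where "p \<in> level l" "q \<in> delta A p (\<alpha> l)" by (auto simp: delta_set_def)
    then show ?thesis using stage_pred_closed q by blast
  qed
  obtain L where L: "stage k L = {}"
  proof (rule ccontr)
    assume "\<not> thesis"
    then have "\<And>l. stage k l \<noteq> {}" using that by blast
    then obtain \<rho> where "\<forall>l. \<rho> l \<in> stage k l \<and> \<rho> (Suc l) \<in> delta A (\<rho> l) (\<alpha> l)"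
      using koenig[of "stage k" "\<lambda>l p q. q \<in> delta A p (\<alpha> l)"] pred
        finite_subset[OF stage_subset_level finite_level] by blast
    then have "\<rho> 0 \<in> stage (Suc k) 0"
      using assms(1) by (auto simp: stage_Suc_iff ipath_def)
    then show False using assms(2) by blast
  qed
  have "stage k l = {}" if "l \<ge> L" for l
    using that by (induction l rule: dec_induct) (use L pred in blast)+
  then show ?thesis by blast
qed

lemma tight_levels_ex:
  assumes rej: "\<alpha> \<notin> language A" and ne: "\<And>l. level l \<noteq> {}"
  shows "\<exists>m>0. \<exists>L. m \<le> card (states A) \<and> (\<forall>l\<ge>L. stage (2 * m) l = {} \<and>
    (\<forall>k. odd k \<longrightarrow> k < 2 * m \<longrightarrow> stage k l - stage (Suc k) l \<noteq> {}))"
proof -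
  have "\<exists>m. \<forall>l. stage (2 * m + 1) l = {}"
  proof (rule ccontr)
    assume no: "\<not> ?thesis"
    have "\<exists>l. stage k l \<noteq> {}" if "odd k" for k
      using no that by (metis oddE)
    \<comment> \<open>The odd numbers below \<open>2 * (card (states A) + 1)\<close> are one more
      than there are states.\<close>
    then obtain L where "\<forall>l\<ge>L. \<forall>k\<le>2 * card (states A) + 2. odd k \<longrightarrow> stage k l - stage (Suc k) l \<noteq> {}"
      using stage_odd_eventually[OF rej] by meson
    then have "card (states A) + 1 \<le> card (states A)"
      by (intro card_odd_stages[of _ L]) auto
    then show False by simp
  qed
  \<comment> \<open>Minimality of \<open>m\<close> makes all smaller odd stages nonempty, so all odd
    values up to \<open>2 * m - 1\<close> will occur as ranks.\<close>
  then obtain m where m: "\<forall>l. stage (2 * m + 1) l = {}"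
    and least: "\<And>i. i < m \<Longrightarrow> \<not> (\<forall>l. stage (2 * i + 1) l = {})"
    using exists_least_iff[of "\<lambda>m. \<forall>l. stage (2 * m + 1) l = {}"] by blast
  obtain L1 where L1: "\<forall>l\<ge>L1. stage (2 * m) l = {}"
    using stage_dies_out[of "2 * m"] m by auto
  have "m > 0"
  proof (rule ccontr)
    assume "\<not> m > 0"
    then show False using L1 ne by auto
  qed
  have "\<exists>l. stage k l \<noteq> {}" if k: "odd k" "k \<le> 2 * m - 1" for k
  proof -
    obtain i where "k = 2 * i + 1" using k(1) by (rule oddE)
    then show ?thesis using least[of i] k(2) \<open>m > 0\<close> by auto
  qed
  then obtain L2 where L2: "\<forall>l\<ge>L2. \<forall>k\<le>2 * m - 1. odd k \<longrightarrow> stage k l - stage (Suc k) l \<noteq> {}"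
    using stage_odd_eventually[OF rej] by meson
  have L: "\<forall>l\<ge>max L1 L2. stage (2 * m) l = {} \<and>
    (\<forall>k. odd k \<longrightarrow> k < 2 * m \<longrightarrow> stage k l - stage (Suc k) l \<noteq> {})"
    using L1 L2 by auto
  then have "m \<le> card (states A)"
    by (intro card_odd_stages[of _ "max L1 L2"]) auto
  then show ?thesis using L \<open>m > 0\<close> by blast
qed


section \<open>The ranking of a rejected word\<close>

text \<open>The Kupferman-Vardi rank: the index of the last stage containing the vertex. It is
  meaningful for vertices of the level once some stage is empty there; otherwise
  \<open>LEAST\<close> may lack a witness.\<close>

definition vrank :: "nat \<Rightarrow> 'q \<Rightarrow> nat" where
  "vrank l q = (LEAST k. q \<notin> stage (Suc k) l)"

text \<open>Turns comparisons of ranks into membership in stages, the form in which the ranking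
  conditions are verified.\<close>

lemma le_vrank_iff:
  assumes "q \<in> level l" "stage M l = {}"
  shows "k \<le> vrank l q \<longleftrightarrow> q \<in> stage k l"
proof -
  have "\<exists>k. q \<notin> stage (Suc k) l"
    using stage_antimono[of M "Suc M" l] assms(2) by auto
  then have out: "q \<notin> stage (Suc (vrank l q)) l"
    unfolding vrank_def by (rule LeastI_ex)
  have "q \<in> stage (vrank l q) l"
  proof (cases "vrank l q")
    case 0
    then show ?thesis using assms by simp
  next
    case (Suc k)
    then have "k < vrank l q" by simp
    then show ?thesis unfolding vrank_def using not_less_Least Suc vrank_def by fastforce
  qed
  then show ?thesis using out stage_antimono
    by (metis not_less_eq_eq subsetD)
qed

lemma vrank_eqI:
  assumes "q \<in> stage k l - stage (Suc k) l" "stage M l = {}"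
  shows "vrank l q = k"
  using assms le_vrank_iff[of q l M k] le_vrank_iff[of q l M "Suc k"] stage_subset_level[of k l]
  by auto

text \<open>The rank is odd and its bound is even. Thus every even index up to the rank is
  admissible in \<open>schewe_Q2\<close>.\<close>

lemma tight_rank_less:
  assumes "tight A S f" "S \<subseteq> states A"
  shows "rank A f < 2 * card (states A)"
proof -
  have "rank A f \<in> f ` S" using assms(1) by (auto simp: tight_def)
  then have "rank A f \<le> 2 * card (states A)"
    using assms by (auto simp: tight_def rankings_def)
  moreover have "odd (rank A f)" using assms(1) by (simp add: tight_def)
  ultimately show ?thesis by (metis dvd_triv_left le_neq_implies_less)
qed

text \<open>The last conjunct is what later empties the obligation sets: a path of constant even
  rank \<open>c\<close> would lie in \<open>stage c\<close> and thereby witness its own survival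
  into the next stage.\<close>

lemma tight_run_ranking_ex:
  assumes rej: "\<alpha> \<notin> language A" and ne: "\<And>l. level l \<noteq> {}"
  shows "\<exists>R L f. (\<forall>l\<ge>L. tight A (level l) (f l) \<and> rank A (f l) = R \<and>
      rank_step A (\<alpha> l) (level l) (f l) (f (Suc l))) \<and>
    (\<forall>l\<ge>L. \<forall>\<rho> c. even c \<longrightarrow> ipath level l \<rho> \<longrightarrow> \<not> (\<forall>j\<ge>l. f j (\<rho> j) = c))"
proof -
  obtain m L where m: "m > 0" "m \<le> card (states A)"
    and empty: "\<And>l. l \<ge> L \<Longrightarrow> stage (2 * m) l = {}"
    and occ: "\<And>l k. l \<ge> L \<Longrightarrow> odd k \<Longrightarrow> k < 2 * m \<Longrightarrow> stage k l - stage (Suc k) l \<noteq> {}"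
    using tight_levels_ex[OF rej ne] by blast
  \<comment> \<open>Tightness requires the value 0 off the level, and \<open>restrict\<close> makes
    the ranking extensional.\<close>
  define f where "f l = restrict (\<lambda>q. if q \<in> level l then vrank l q else 0) (states A)" for l
  have f_level: "f l q = vrank l q" if "q \<in> level l" for l q
    using that level_subset by (auto simp: f_def)
  have le_iff: "k \<le> f l q \<longleftrightarrow> q \<in> stage k l" if "l \<ge> L" "q \<in> level l" for k l q
    using le_vrank_iff that empty f_level by metis
  have less: "f l q < 2 * m" if "l \<ge> L" "q \<in> states A" for l q
    using le_iff[of l q "2 * m"] that empty[of l] m(1)
    by (cases "q \<in> level l") (auto simp: f_def)
  have occ': "k \<in> f l ` level l" if k: "l \<ge> L" "odd k" "k < 2 * m" for l k
  proof -
    obtain q where q: "q \<in> stage k l - stage (Suc k) l" using occ[OF k] by blast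
    then have "q \<in> level l" using stage_subset_level by blast
    moreover have "vrank l q = k" using vrank_eqI q empty k(1) by blast
    ultimately show ?thesis using f_level by (metis image_eqI)
  qed
  have rank: "rank A (f l) = 2 * m - 1" if "l \<ge> L" for l
    unfolding rank_def
  proof (rule Max_eqI)
    show "2 * m - 1 \<in> f l ` states A"
      using occ'[OF that, of "2 * m - 1"] m(1) level_subset by auto
    show "y \<le> 2 * m - 1" if "y \<in> f l ` states A" for y
      using less[OF \<open>l \<ge> L\<close>] that by fastforce
  qed (use finite_states in simp)
  have even_acc: "even (f l q)" if "l \<ge> L" "q \<in> acc_states A" for l q
  proof (cases "q \<in> level l")
    case True
    show ?thesis
    proof (rule ccontr)
      assume "odd (f l q)"
      moreover have "q \<in> stage (f l q) l" using le_iff True that by blast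
      ultimately have "q \<in> stage (Suc (f l q)) l" using stage_acc_state that by blast
      then show False using le_iff[OF that(1) True, of "Suc (f l q)"] by simp
    qed
  next
    case False
    then show ?thesis using that ba by (auto simp: f_def buchi_automaton_def)
  qed
  have ext: "f l \<in> states A \<rightarrow>\<^sub>E {0..2 * card (states A)}" if "l \<ge> L" for l
  proof
    show "f l q \<in> {0..2 * card (states A)}" if "q \<in> states A" for q
      using less[OF \<open>l \<ge> L\<close> that] m(2) by simp
  qed (simp add: f_def)
  have tight: "tight A (level l) (f l)" if "l \<ge> L" for l
  proof -
    have "{k. odd k \<and> k \<le> 2 * m - 1} \<subseteq> f l ` level l"
      using occ'[OF that] m(1) by auto
    moreover have "\<forall>q\<in>states A - level l. f l q = 0"
      by (simp add: f_def)
    ultimately show ?thesis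
      using rank[OF that] m(1) ext[OF that] even_acc[OF that] by (simp add: tight_def rankings_def)
  qed
  have step: "rank_step A (\<alpha> l) (level l) (f l) (f (Suc l))" if l: "l \<ge> L" for l
    unfolding rank_step_def
  proof (intro ballI conjI)
    fix q q' assume q: "q \<in> level l" "q' \<in> delta A q (\<alpha> l)"
    then have "q' \<in> stage (f (Suc l) q') (Suc l)"
      using le_iff[of "Suc l" q' "f (Suc l) q'"] level_step l by auto
    then show "f (Suc l) q' \<le> f l q"
      using le_iff stage_pred_closed q l by blast
  next
    fix q q' assume q: "q \<in> level l" "q' \<in> delta_acc A q (\<alpha> l)"
    then have edge: "q' \<in> delta A q (\<alpha> l)" and good: "good l q q'"
      using ba by (auto simp: delta_acc_def good_def buchi_automaton_def)
    define k where "k = f (Suc l) q'"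
    have q': "q' \<in> stage k (Suc l)"
      using le_iff[of "Suc l" q' k] level_step q edge l by (auto simp: k_def)
    then have qk: "q \<in> stage k l"
      using stage_pred_closed q edge by blast
    \<comment> \<open>For even \<open>k\<close>, rounding down cannot fall below \<open>k\<close>.
      For odd \<open>k\<close> the good edge lifts \<open>q\<close> to the even stage
      \<open>Suc k\<close>.\<close>
    show "k \<le> even_floor (f l q)"
    proof (cases "even k")
      case True
      then show ?thesis using le_iff[OF l q(1), of k] qk
        by (cases "k = f l q") (auto simp: even_floor_eq)
    next
      case False
      then have "q \<in> stage (Suc k) l"
        using stage_odd_good qk q' edge good by blast
      then show ?thesis using le_iff[OF l q(1), of "Suc k"] by (auto simp: even_floor_eq)
    qed
  qed
  have notrap: "\<not> (\<forall>j\<ge>l. f j (\<rho> j) = c)" if "l \<ge> L" "even c" "ipath level l \<rho>" for l \<rho> c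
  proof
    assume c: "\<forall>j\<ge>l. f j (\<rho> j) = c"
    then have "\<rho> j \<in> stage c j" if "j \<ge> l" for j
      using le_iff[of j "\<rho> j" c] that \<open>l \<ge> L\<close> \<open>ipath level l \<rho>\<close> by (auto simp: ipath_def)
    then have "\<rho> l \<in> stage (Suc c) l"
      using that by (auto simp: stage_Suc_iff ipath_def)
    then show False
      using le_iff[of l "\<rho> l" "Suc c"] that c by (auto simp: ipath_def)
  qed
  show ?thesis
    using tight rank step notrap by blast
qed

section \<open>Runs of the complement automaton on rejected words\<close>

lemma schewe_simps:
  "states (schewe A) = schewe_Q1 A \<union> schewe_Q2 A"
  "initial (schewe A) = {Waiting (initial A)}"
  "acc_trans (schewe A) = {}"
  "acc_states (schewe A) = {Waiting {}} \<union> {Tight S {} f i | S f i. Tight S {} f i \<in> schewe_Q2 A}"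
  "s' \<in> delta (schewe A) s a \<longleftrightarrow> s \<in> schewe_Q1 A \<union> schewe_Q2 A \<and>
     s' \<in> schewe_Q1 A \<union> schewe_Q2 A \<and> schewe_step A s a s'"
  by (auto simp: schewe_def)

lemma finite_acc_states_schewe: "finite (acc_states (schewe A))"
  using buchi_automaton_schewe[OF ba] by (auto simp: buchi_automaton_def intro: finite_subset)

lemma accepting_run_schewe_iff:
  "accepting_run (schewe A) \<alpha> \<sigma> \<longleftrightarrow> (\<exists>\<^sub>\<infinity>j. \<sigma> j \<in> acc_states (schewe A))"
  using frequently_bex_finite_distrib[OF finite_acc_states_schewe,
      of "\<lambda>j q. \<sigma> j = q" cofinite]
  by (simp add: accepting_run_def schewe_simps(3))

text \<open>The run that stays in the subset part reaches the accepting state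
  \<open>Waiting {}\<close> and never leaves it.\<close>

lemma schewe_accepts_dead:
  assumes "level l0 = {}"
  shows "\<alpha> \<in> language (schewe A)"
proof -
  have dead: "level l = {}" if "l \<ge> l0" for l
    using that by (induction l rule: dec_induct) (auto simp: assms delta_set_def)
  define \<sigma> where "\<sigma> l = Waiting (level l)" for l
  have "is_run (schewe A) \<alpha> (Waiting (initial A)) \<sigma>"
    using level_subset by (auto simp: is_run_def schewe_simps \<sigma>_def schewe_Q1_def simp flip: level.simps(2))
  moreover have "accepting_run (schewe A) \<alpha> \<sigma>"
    unfolding accepting_run_schewe_iff INFM_nat_le
    using dead by (auto simp: schewe_simps(4) \<sigma>_def) (meson nat_le_linear order_refl)
  ultimately show ?thesis by (auto simp: language_def schewe_simps(2))
qed

lemma schewe_accepts: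
  assumes rej: "\<alpha> \<notin> language A" and ne: "\<And>l. level l \<noteq> {}"
  shows "\<alpha> \<in> language (schewe A)"
proof -
  obtain R K f where *: "\<forall>l\<ge>K. tight A (level l) (f l) \<and> rank A (f l) = R \<and>
      rank_step A (\<alpha> l) (level l) (f l) (f (Suc l))"
    "\<forall>l\<ge>K. \<forall>\<rho> c. even c \<longrightarrow> ipath level l \<rho> \<longrightarrow> \<not> (\<forall>j\<ge>l. f j (\<rho> j) = c)"
    using tight_run_ranking_ex[OF rej ne] by metis
  \<comment> \<open>\<open>L\<close> is positive, so the run starts in a \<open>Waiting\<close>
    state and enters the tight part at level \<open>L\<close>.\<close>
  define L where "L = Suc K"
  have tight: "\<And>l. l \<ge> L \<Longrightarrow> tight A (level l) (f l)"
    and rank: "\<And>l. l \<ge> L \<Longrightarrow> rank A (f l) = R"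
    and step: "\<And>l. l \<ge> L \<Longrightarrow> rank_step A (\<alpha> l) (level l) (f l) (f (Suc l))"
    and notrap: "\<And>l \<rho> c. l \<ge> L \<Longrightarrow> even c \<Longrightarrow> ipath level l \<rho> \<Longrightarrow> \<exists>j\<ge>l. f j (\<rho> j) \<noteq> c"
    using * by (auto simp: L_def)
  have R: "odd R" "R < 2 * card (states A)"
    using tight[of L] rank[of L] tight_rank_less[of "level L" "f L"] level_subset
    by (auto simp: tight_def)
  \<comment> \<open>Once the rankings are fixed, the transition rule determines obligation set and
    index; they are iterated from the entry values, with \<open>n\<close> counting levels after
    \<open>L\<close>.\<close>
  define oi where "oi = rec_nat ({} :: 'q set, 0 :: nat) (\<lambda>n (ob, i).
     if ob = {} then (level (Suc (L + n)) \<inter> f (Suc (L + n)) -` {(i + 2) mod (R + 1)}, (i + 2) mod (R + 1))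
     else (delta_set A ob (\<alpha> (L + n)) \<inter> f (Suc (L + n)) -` {i}, i))"
  define Ob where "Ob l = fst (oi (l - L))" for l
  define i where "i l = snd (oi (l - L))" for l
  have L0: "Ob L = {}" "i L = 0" by (auto simp: Ob_def i_def oi_def)
  have oi_empty: "i (Suc l) = (i l + 2) mod (R + 1)" "Ob (Suc l) = level (Suc l) \<inter> f (Suc l) -` {i (Suc l)}"
    if "l \<ge> L" "Ob l = {}" for l
    using that by (auto simp: Ob_def i_def oi_def Suc_diff_le case_prod_beta simp del: level.simps)
  have oi_ne: "i (Suc l) = i l" "Ob (Suc l) = delta_set A (Ob l) (\<alpha> l) \<inter> f (Suc l) -` {i l}"
    if "l \<ge> L" "Ob l \<noteq> {}" for l
    using that by (auto simp: Ob_def i_def oi_def Suc_diff_le case_prod_beta simp del: level.simps)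
  have inv: "even (i l) \<and> i l \<le> R \<and> Ob l \<subseteq> level l \<inter> f l -` {i l}" if "l \<ge> L" for l
    using that
  proof (induction l rule: dec_induct)
    case base
    then show ?case by (simp add: L0)
  next
    case (step l)
    show ?case
    proof (cases "Ob l = {}")
      case True
      \<comment> \<open>Parity survives the reduction because \<open>R + 1\<close> is even.\<close>
      have "even ((i l + 2) mod (R + 1))"
        using step R(1) by (simp add: dvd_mod)
      moreover have "(i l + 2) mod (R + 1) \<le> R"
        using mod_less_divisor[of "R + 1" "i l + 2"] by linarith
      ultimately show ?thesis using oi_empty[OF step(1) True] by simp
    next
      case False
      then show ?thesis using oi_ne[OF step(1) False] step by (auto simp: delta_set_def)
    qed
  qed
  define \<sigma> where "\<sigma> l = (if l < L then Waiting (level l) else Tight (level l) (Ob l) (f l) (i l))" for l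
  have Q2: "Tight (level l) (Ob l) (f l) (i l) \<in> schewe_Q2 A" if "l \<ge> L" for l
  proof -
    have "tight A (states A) (f l)"
      using tight[OF that] level_subset by (fastforce simp: tight_def)
    then show ?thesis
      using inv[OF that] tight[OF that] level_subset[of l] R(2)
      by (auto simp: schewe_Q2_def tight_rankings_def)
  qed
  then have in_Q: "\<sigma> l \<in> schewe_Q1 A \<union> schewe_Q2 A" for l
    using level_subset by (auto simp: \<sigma>_def schewe_Q1_def)
  have "schewe_step A (\<sigma> l) (\<alpha> l) (\<sigma> (Suc l))" for l
  proof (cases "l \<ge> L")
    case True
    then show ?thesis
      using step[OF True] rank[of l] rank[of "Suc l"] oi_empty[OF True] oi_ne[OF True]
      by (auto simp: \<sigma>_def)
  next
    case False
    then show ?thesis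
      using L0 by (cases "Suc l = L") (auto simp: \<sigma>_def)
  qed
  moreover have "\<sigma> 0 = Waiting (initial A)"
    by (simp add: \<sigma>_def L_def)
  ultimately have "is_run (schewe A) \<alpha> (Waiting (initial A)) \<sigma>"
    using in_Q by (auto simp: is_run_def schewe_simps)
  \<comment> \<open>If the obligations never emptied again, the index would freeze and each
    obligation would have a predecessor among the previous ones. Koenig's lemma then gives a path of
    constant even rank, against \<open>notrap\<close>.\<close>
  moreover have "\<exists>l\<ge>n. Ob l = {}" if "n \<ge> L" for n
  proof (rule ccontr)
    assume "\<not> ?thesis"
    then have Ob_ne: "Ob l \<noteq> {}" if "l \<ge> n" for l using that by blast
    have i_const: "i l = i n" if "l \<ge> n" for l
      using that by (induction l rule: dec_induct) (simp, metis oi_ne(1) Ob_ne \<open>n \<ge> L\<close> order_trans)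
    have "\<exists>\<rho>. \<forall>l. \<rho> l \<in> Ob (n + l) \<and> \<rho> (Suc l) \<in> delta A (\<rho> l) (\<alpha> (n + l))"
    proof (rule koenig[where L = "\<lambda>l. Ob (n + l)"])
      show "finite (Ob (n + l))" for l
        using inv[of "n + l"] that finite_subset[OF _ finite_level[of "n + l"]] by auto
      show "Ob (n + l) \<noteq> {}" for l using Ob_ne by simp
      show "\<exists>v\<in>Ob (n + l). w \<in> delta A v (\<alpha> (n + l))" if "w \<in> Ob (n + Suc l)" for l w
        using that oi_ne[of "n + l"] Ob_ne[of "n + l"] \<open>n \<ge> L\<close> by (auto simp: delta_set_def)
    qed
    then obtain \<rho> where \<rho>: "\<And>l. \<rho> l \<in> Ob (n + l)"
      "\<And>l. \<rho> (Suc l) \<in> delta A (\<rho> l) (\<alpha> (n + l))" by blast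
    define \<pi> where "\<pi> l = \<rho> (l - n)" for l
    have \<pi>: "\<pi> l \<in> Ob l" "\<pi> (Suc l) \<in> delta A (\<pi> l) (\<alpha> l)" if "l \<ge> n" for l
      using \<rho>(1)[of "l - n"] \<rho>(2)[of "l - n"] that by (auto simp: \<pi>_def Suc_diff_le)
    have \<pi>_inv: "\<pi> l \<in> level l" "f l (\<pi> l) = i n" if "l \<ge> n" for l
      using \<pi>(1)[OF that] inv[of l] i_const[OF that] that \<open>n \<ge> L\<close> by auto
    then have "ipath level n \<pi>"
      using \<pi>(2) by (simp add: ipath_def)
    moreover have "\<forall>l\<ge>n. f l (\<pi> l) = i n"
      using \<pi>_inv(2) by blast
    ultimately show False using notrap[OF that, of "i n" \<pi>] inv[OF that] by blast
  qed
  then have "accepting_run (schewe A) \<alpha> \<sigma>"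
    unfolding accepting_run_schewe_iff INFM_nat_le schewe_simps(4)
    using Q2 by (auto simp: \<sigma>_def) (metis le_trans max.cobounded1 max.cobounded2 not_less)
  ultimately show ?thesis by (auto simp: language_def schewe_simps(2))
qed

section \<open>Accepted words are rejected by the complement\<close>

text \<open>With infinitely many empty obligation sets, the index would cycle through all even
  values up to the rank. It would thus hit the limit rank of the accepting path, after which the
  obligations contain that path forever.\<close>

lemma schewe_rejects:
  assumes "\<alpha> \<in> language A"
  shows "\<alpha> \<notin> language (schewe A)"
proof
  assume "\<alpha> \<in> language (schewe A)"
  then obtain \<sigma> where run: "is_run (schewe A) \<alpha> (Waiting (initial A)) \<sigma>"
    and inf: "\<exists>\<^sub>\<infinity>j. \<sigma> j \<in> acc_states (schewe A)"
    by (auto simp: language_def schewe_simps(2) accepting_run_schewe_iff)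
  obtain q \<rho> where \<rho>: "q \<in> initial A" "is_run A \<alpha> q \<rho>" "accepting_run A \<alpha> \<rho>"
    using assms by (auto simp: language_def)
  have \<rho>_level: "\<rho> l \<in> level l" for l
    using run_in_level \<rho> by blast
  have \<rho>_step: "\<rho> (Suc l) \<in> delta A (\<rho> l) (\<alpha> l)" for l
    using \<rho>(2) by (simp add: is_run_def)
  have \<rho>_good: "\<exists>\<^sub>\<infinity>j. good j (\<rho> j) (\<rho> (Suc j))"
    using accepting_run_iff_good \<rho> by blast
  have step: "schewe_step A (\<sigma> l) (\<alpha> l) (\<sigma> (Suc l))" and in_Q: "\<sigma> l \<in> schewe_Q1 A \<union> schewe_Q2 A"
    for l using run by (auto simp: is_run_def schewe_simps)
  have form: "\<sigma> l = Waiting (level l) \<or> (\<exists>Ob f i. \<sigma> l = Tight (level l) Ob f i)" for l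
  proof (induction l)
    case 0
    then show ?case using run by (simp add: is_run_def)
  next
    case (Suc l)
    then show ?case using step[of l] by (cases "\<sigma> (Suc l)") auto
  qed
  \<comment> \<open>In the subset part only the empty set is accepting, but the accepting path keeps
    every level nonempty.\<close>
  have "\<exists>k. \<forall>S. \<sigma> k \<noteq> Waiting S"
  proof (rule ccontr)
    assume "\<not> ?thesis"
    then have "\<sigma> l = Waiting (level l)" for l
      using form[of l] by (metis schewe_state.distinct(1))
    moreover obtain l where "\<sigma> l \<in> acc_states (schewe A)"
      using inf by (auto simp: INFM_nat_le)
    ultimately show False using \<rho>_level[of l] by (auto simp: schewe_simps(4))
  qed
  then obtain k where k: "\<exists>Ob f i. \<sigma> k = Tight (level k) Ob f i"
    using form by metis
  \<comment> \<open>No transition leads from the tight part back to the subset part.\<close>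
  have "\<exists>Ob f i. \<sigma> l = Tight (level l) Ob f i" if "l \<ge> k" for l
    using that
  proof (induction l rule: dec_induct)
    case (step l)
    then show ?case using \<open>\<And>l. schewe_step A (\<sigma> l) (\<alpha> l) (\<sigma> (Suc l))\<close>[of l] form[of "Suc l"] by auto
  qed (use k in blast)
  then obtain Ob f i where \<sigma>: "\<And>l. l \<ge> k \<Longrightarrow> \<sigma> l = Tight (level l) (Ob l) (f l) (i l)"
    by metis
  have st: "rank_step A (\<alpha> l) (level l) (f l) (f (Suc l))" "rank A (f (Suc l)) = rank A (f l)"
    "if Ob l = {} then i (Suc l) = (i l + 2) mod (rank A (f (Suc l)) + 1) \<and>
       Ob (Suc l) = level (Suc l) \<inter> f (Suc l) -` {i (Suc l)}
     else i (Suc l) = i l \<and> Ob (Suc l) = delta_set A (Ob l) (\<alpha> l) \<inter> f (Suc l) -` {i l}"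
    if "l \<ge> k" for l
    using step[of l] \<sigma>[of l] \<sigma>[of "Suc l"] that by auto
  have Q2: "even (i l)" "tight A (level l) (f l)" if "l \<ge> k" for l
    using in_Q[of l] \<sigma>[OF that] by (auto simp: schewe_Q1_def schewe_Q2_def)
  define R where "R = rank A (f k)"
  have R: "rank A (f l) = R" if "l \<ge> k" for l
    using that by (induction l rule: dec_induct) (auto simp: R_def st)
  have odd_R: "odd R" using Q2(2)[of k] by (simp add: R_def tight_def)
  have Ob_inf: "\<exists>l\<ge>n. Ob l = {}" if n: "n \<ge> k" for n
  proof -
    obtain l where "l \<ge> n" "\<sigma> l \<in> acc_states (schewe A)"
      using inf by (auto simp: INFM_nat_le)
    then show ?thesis using \<sigma>[of l] n by (auto simp: schewe_simps(4))
  qed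
  have "f (Suc l) (\<rho> (Suc l)) \<le> f l (\<rho> l)" if "l \<ge> k" for l
    using st(1)[OF that] \<rho>_level \<rho>_step by (auto simp: rank_step_def)
  then obtain m where m: "m \<ge> k" "\<And>l. l \<ge> m \<Longrightarrow> f l (\<rho> l) = f m (\<rho> m)"
    using antimono_nat_eventually_const[of k "\<lambda>l. f l (\<rho> l)"] by blast
  define c where "c = f m (\<rho> m)"
  have c: "f l (\<rho> l) = c" if "l \<ge> m" for l unfolding c_def by (rule m(2)[OF that])
  \<comment> \<open>Beyond \<open>m\<close> a good edge occurs. Its source is accepting and has even
    rank, or the edge is accepting and forces \<open>c \<le> even_floor c\<close>.\<close>
  have "even c"
  proof -
    obtain l where l: "l \<ge> m" "good l (\<rho> l) (\<rho> (Suc l))"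
      using \<rho>_good by (auto simp: INFM_nat_le)
    show ?thesis
    proof (cases "\<rho> l \<in> acc_states A")
      case True
      then show ?thesis using Q2(2)[of l] c[of l] l m(1) by (auto simp: tight_def rankings_def)
    next
      case False
      then have "\<rho> (Suc l) \<in> delta_acc A (\<rho> l) (\<alpha> l)"
        using l by (simp add: good_def delta_acc_def)
      then have "c \<le> even_floor c"
        using st(1)[of l] \<rho>_level[of l] c[of l] c[of "Suc l"] l(1) m(1)
        unfolding rank_step_def by (metis le_SucI le_trans)
      then show ?thesis by (cases c) (auto simp: even_floor_eq split: if_splits)
    qed
  qed
  have "\<rho> m \<in> states A" using \<rho>_level level_subset by blast
  then have "c \<le> R"
    using R[OF m(1)] finite_states by (auto simp: c_def rank_def)
  \<comment> \<open>The index is frozen up to the first empty obligation set at or after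
    \<open>n\<close>, and then advances by 2.\<close>
  have reset: "\<exists>l\<ge>n. Ob l = {} \<and> i (Suc l) = (i n + 2) mod (R + 1)" if n: "n \<ge> m" for n
  proof -
    define l where "l = (LEAST l. l \<ge> n \<and> Ob l = {})"
    have l: "l \<ge> n" "Ob l = {}"
      using LeastI_ex[of "\<lambda>l. l \<ge> n \<and> Ob l = {}"] Ob_inf[of n] n m(1) by (auto simp: l_def)
    have "i j = i n" if "n \<le> j" "j \<le> l" for j
      using that
    proof (induction j rule: dec_induct)
      case (step j)
      then have "Ob j \<noteq> {}"
        using not_less_Least[of j "\<lambda>l. l \<ge> n \<and> Ob l = {}"] by (auto simp: l_def)
      then show ?case using st(3)[of j] step n m(1) by auto
    qed simp
    then have "i l = i n" using l(1) by blast
    then have "i (Suc l) = (i n + 2) mod (R + 1)"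
      using l st(3)[of l] R[of "Suc l"] n m(1) by simp
    then show ?thesis using l by blast
  qed
  have cycle: "\<exists>l\<ge>m. Ob l = {} \<and> i (Suc l) = (i m + 2 * Suc d) mod (R + 1)" for d
  proof (induction d)
    case 0
    then show ?case using reset[of m] by simp
  next
    case (Suc d)
    then obtain l where l: "l \<ge> m" "i (Suc l) = (i m + 2 * Suc d) mod (R + 1)" by blast
    obtain l' where l': "l' \<ge> Suc l" "Ob l' = {}" "i (Suc l') = (i (Suc l) + 2) mod (R + 1)"
      using reset[of "Suc l"] l(1) by auto
    have "i (Suc l') = (i m + 2 * Suc (Suc d)) mod (R + 1)"
      unfolding l'(3) l(2) mod_add_left_eq by (simp add: algebra_simps)
    then show ?case using l l' by (intro exI[of _ l']) auto
  qed
  have "\<exists>n\<ge>m. i (Suc n) = c \<and> Ob n = {}"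
  proof -
    \<comment> \<open>\<open>N\<close> is the advance from \<open>i m\<close> to \<open>c\<close>
      modulo \<open>R + 1\<close>. The added multiple exceeds \<open>i m\<close>, so the subtraction
      does not truncate and \<open>N\<close> is positive.\<close>
    define N where "N = c + (R + 1) * (i m + 1) - i m"
    have N: "i m + N = c + (R + 1) * (i m + 1)" "N > 0"
      by (auto simp: N_def)
    have "even (i m + N)" unfolding N(1) using \<open>even c\<close> odd_R by simp
    then have "even N" using Q2(1)[OF m(1)] by simp
    then obtain e where "N = 2 * e" by blast
    moreover from this obtain d where "e = Suc d" using N(2) by (cases e) auto
    ultimately have "N = 2 * Suc d" by simp
    then obtain l where "l \<ge> m" "Ob l = {}" "i (Suc l) = (c + (R + 1) * (i m + 1)) mod (R + 1)"
      using cycle[of d] N(1) by metis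
    moreover have "(c + (R + 1) * (i m + 1)) mod (R + 1) = c"
      using \<open>c \<le> R\<close> unfolding mod_mult_self2 by simp
    ultimately show ?thesis by metis
  qed
  then obtain n where n: "n \<ge> m" "i (Suc n) = c" "Ob n = {}" by blast
  \<comment> \<open>At \<open>Suc n\<close> the obligations are all vertices of the level with rank
    \<open>c\<close>, including that of \<open>\<rho>\<close>. The set is then nonempty, so it is
    propagated along edges and \<open>\<rho>\<close> stays in it.\<close>
  have "\<rho> l \<in> Ob l \<and> i l = c" if "l \<ge> Suc n" for l
    using that
  proof (induction l rule: dec_induct)
    case base
    then show ?case using st(3)[of n] n m(1) c[of "Suc n"] \<rho>_level[of "Suc n"] by auto
  next
    case (step l)
    then show ?case using st(3)[of l] n m(1) c[of "Suc l"] \<rho>_step[of l]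
      by (auto simp: delta_set_def split: if_splits)
  qed
  then show False using Ob_inf[of "Suc n"] n m(1) by auto
qed

end

theorem theorem1:
  fixes A :: "('q, 'a :: finite) ba"
  assumes "buchi_automaton A"
  shows "language (schewe A) = UNIV - language A"
proof -
  have "\<alpha> \<in> language (schewe A) \<longleftrightarrow> \<alpha> \<notin> language A" for \<alpha>
  proof -
    interpret ba_word A \<alpha> using assms by unfold_locales
    \<comment> \<open>For a rejected word the cases are whether or not some level is empty.\<close>
    show ?thesis using schewe_accepts schewe_accepts_dead schewe_rejects by blast
  qed
  then show ?thesis by blast
qed

end
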